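(* Let $(\mathfrak g,\langle\cdot,\cdot\rangle)$ be a $5$-dimensional metric Lie algebra admitting a strict CKY $2$-form whose co-differential lies in the dual of the center of $\mathfrak g$. Then $\mathcal{KY}^2(\mathfrak g,\langle\cdot,\cdot\rangle)=0$, and $\mathcal{*KY}^2(\mathfrak g,\langle\cdot,\cdot\rangle)=\mathcal{CKY}^2(\mathfrak g,\langle\cdot,\cdot\rangle)$ is $1$-dimensional. In particular, $(\mathfrak g,\langle\cdot,\cdot\rangle)$ does not admit non-zero parallel skew-symmetric tensors (i.e. skew-symmetric endomorphisms $T\neq 0$ with $\nabla T=0$).
   Context: A metric Lie algebra $(\mathfrak g,\langle\cdot,\cdot\rangle)$ is a finite-dimensional real Lie algebra with an inner product; $\nabla$ is given by $2\langle\nabla_xy,z\rangle=\langle[x,y],z\rangle-\langle[y,z],x\rangle+\langle[z,x],y\rangle$, and $(\nabla_xT)y=\nabla_x(Ty)-T(\nabla_xy)$. A $2$-form $\omega\in\Lambda^2\mathfrak g^*$ corresponds to the skew-symmetric endomorphism $T$ with $\omega(x,y)=\langle Tx,y\rangle$. $\omega$ is CKY (conformal Killing-Yano) if there is $\theta\in\mathfrak g^*$ with $$\langle(\nabla_xT)y,z\rangle+\langle(\nabla_yT)x,z\rangle=2\langle x,y\rangle\theta(z)-\langle y,z\rangle\theta(x)-\langle x,z\rangle\theta(y)\quad\text{for all }x,y,z\in\mathfrak g;$$ then $\theta=-\frac1{n-1}d^*\omega$ where $n=\dim\mathfrak g$. It is strict if $\theta\neq0$, and KY (Killing-Yano) if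 $\theta=0$. The associated vector is the $\xi\in\mathfrak g$ with $\theta=\langle\xi,\cdot\rangle$; "the co-differential lies in the dual of the center" means $\xi$ belongs to the center of $\mathfrak g$. A $*$-KY form is a closed CKY form, where $d\omega(x,y,z)=-\omega([x,y],z)-\omega([y,z],x)-\omega([z,x],y)$. $\mathcal{CKY}^2$, $\mathcal{KY}^2$, $\mathcal{*KY}^2$ denote the vector spaces of CKY, KY and $*$-KY $2$-forms on $(\mathfrak g,\langle\cdot,\cdot\rangle)$ (all forms being elements of $\Lambda^2\mathfrak g^*$, i.e. left invariant). *)

theory Defs
  imports "HOL-Analysis.Analysis"
begin

text \<open>
  A metric Lie algebra is a Lie bracket \<open>br\<close> on a Euclidean space type; the metric is the inner
  product of the type, and the dimension is \<open>DIM('a)\<close>.  Since linear and bounded linear maps agree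
  in finite dimension, linear forms are elements of \<open>'a \<Rightarrow>\<^sub>L real\<close> and bilinear forms are elements
  of \<open>'a \<Rightarrow>\<^sub>L 'a \<Rightarrow>\<^sub>L real\<close>; these are real vector spaces, so \<open>subspace\<close> and \<open>dim\<close> apply to sets of
  forms.
\<close>

locale metric_lie_algebra =
  fixes br :: "'a::euclidean_space \<Rightarrow> 'a \<Rightarrow> 'a"
  assumes bilinear_br: "bilinear br"
    and br_self: "br x x = 0"
    and jacobi: "br x (br y z) + br y (br z x) + br z (br x y) = 0"

definition center :: "('a::euclidean_space \<Rightarrow> 'a \<Rightarrow> 'a) \<Rightarrow> 'a set" where
  "center br = {z. \<forall>x. br z x = 0}"

text \<open>The Levi-Civita connection, determined by the Koszul formula (see \<open>nabla_koszul\<close>).\<close>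

definition nabla :: "('a::euclidean_space \<Rightarrow> 'a \<Rightarrow> 'a) \<Rightarrow> 'a \<Rightarrow> 'a \<Rightarrow> 'a" where
  "nabla br x y = (THE v. \<forall>z. 2 * (v \<bullet> z) = br x y \<bullet> z - br y z \<bullet> x + br z x \<bullet> y)"

definition nabla_endo ::
  "('a::euclidean_space \<Rightarrow> 'a \<Rightarrow> 'a) \<Rightarrow> ('a \<Rightarrow> 'a) \<Rightarrow> 'a \<Rightarrow> 'a \<Rightarrow> 'a" where
  "nabla_endo br T x y = nabla br x (T y) - T (nabla br x y)"

definition skew_symmetric :: "('a::euclidean_space \<Rightarrow> 'a) \<Rightarrow> bool" where
  "skew_symmetric T \<longleftrightarrow> linear T \<and> (\<forall>x y. T x \<bullet> y = - (x \<bullet> T y))"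

definition parallel :: "('a::euclidean_space \<Rightarrow> 'a \<Rightarrow> 'a) \<Rightarrow> ('a \<Rightarrow> 'a) \<Rightarrow> bool" where
  "parallel br T \<longleftrightarrow> (\<forall>x y. nabla_endo br T x y = 0)"

definition two_forms :: "('a::euclidean_space \<Rightarrow>\<^sub>L 'a \<Rightarrow>\<^sub>L real) set" where
  "two_forms = {\<omega>. \<forall>x. blinfun_apply (blinfun_apply \<omega> x) x = 0}"

text \<open>The endomorphism corresponding to a bilinear form (see \<open>endo_of_form_inner\<close>).\<close>

definition endo_of_form :: "('a::euclidean_space \<Rightarrow>\<^sub>L 'a \<Rightarrow>\<^sub>L real) \<Rightarrow> 'a \<Rightarrow> 'a" where
  "endo_of_form \<omega> = (THE T. \<forall>x y. blinfun_apply (blinfun_apply \<omega> x) y = T x \<bullet> y)"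

definition ext_deriv ::
  "('a::euclidean_space \<Rightarrow> 'a \<Rightarrow> 'a) \<Rightarrow> ('a \<Rightarrow>\<^sub>L 'a \<Rightarrow>\<^sub>L real) \<Rightarrow> 'a \<Rightarrow> 'a \<Rightarrow> 'a \<Rightarrow> real" where
  "ext_deriv br \<omega> x y z =
     - blinfun_apply (blinfun_apply \<omega> (br x y)) z
     - blinfun_apply (blinfun_apply \<omega> (br y z)) x
     - blinfun_apply (blinfun_apply \<omega> (br z x)) y"

text \<open>
  The conformal Killing-Yano equation for \<open>\<omega>\<close> with 1-form \<open>\<theta>\<close>.  In dimension at least two \<open>\<theta>\<close> is
  determined by \<open>\<omega>\<close>: it is the multiple \<open>- 1 / (n - 1)\<close> of the codifferential
  (see \<open>CKY_with_theta\<close>).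
\<close>

definition CKY_with ::
  "('a::euclidean_space \<Rightarrow> 'a \<Rightarrow> 'a) \<Rightarrow> ('a \<Rightarrow>\<^sub>L 'a \<Rightarrow>\<^sub>L real) \<Rightarrow> ('a \<Rightarrow>\<^sub>L real) \<Rightarrow> bool" where
  "CKY_with br \<omega> \<theta> \<longleftrightarrow> \<omega> \<in> two_forms \<and>
     (\<forall>x y z. nabla_endo br (endo_of_form \<omega>) x y \<bullet> z + nabla_endo br (endo_of_form \<omega>) y x \<bullet> z =
        2 * (x \<bullet> y) * blinfun_apply \<theta> z - (y \<bullet> z) * blinfun_apply \<theta> x
          - (x \<bullet> z) * blinfun_apply \<theta> y)"

definition CKY2 :: "('a::euclidean_space \<Rightarrow> 'a \<Rightarrow> 'a) \<Rightarrow> ('a \<Rightarrow>\<^sub>L 'a \<Rightarrow>\<^sub>L real) set" where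
  "CKY2 br = {\<omega>. \<exists>\<theta>. CKY_with br \<omega> \<theta>}"

definition KY2 :: "('a::euclidean_space \<Rightarrow> 'a \<Rightarrow> 'a) \<Rightarrow> ('a \<Rightarrow>\<^sub>L 'a \<Rightarrow>\<^sub>L real) set" where
  "KY2 br = {\<omega>. CKY_with br \<omega> 0}"

definition starKY2 :: "('a::euclidean_space \<Rightarrow> 'a \<Rightarrow> 'a) \<Rightarrow> ('a \<Rightarrow>\<^sub>L 'a \<Rightarrow>\<^sub>L real) set" where
  "starKY2 br = {\<omega> \<in> CKY2 br. \<forall>x y z. ext_deriv br \<omega> x y z = 0}"

lemma ex_representing_vector:
  fixes f :: "'a::euclidean_space \<Rightarrow> real"
  assumes "linear f"
  shows "\<exists>!v. \<forall>z. f z = v \<bullet> z"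
proof (rule ex_ex1I)
  show "\<exists>v. \<forall>z. f z = v \<bullet> z"
  proof (intro exI allI)
    fix z show "f z = adjoint f 1 \<bullet> z"
      using adjoint_works[OF assms, of z 1] by (simp add: inner_commute)
  qed
next
  fix v w assume v: "\<forall>z. f z = v \<bullet> z" and w: "\<forall>z. f z = w \<bullet> z"
  have "\<forall>z. v \<bullet> z = w \<bullet> z" using v w by simp
  then show "v = w" by (metis vector_eq_rdot)
qed

lemma (in metric_lie_algebra) nabla_koszul:
  "2 * (nabla br x y \<bullet> z) = br x y \<bullet> z - br y z \<bullet> x + br z x \<bullet> y"
proof -
  let ?f = "\<lambda>z. (br x y \<bullet> z - br y z \<bullet> x + br z x \<bullet> y) / 2"
  have "linear ?f"
    using bilinear_br
    by (intro linearI)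
      (simp_all add: bilinear_radd bilinear_ladd bilinear_rmul bilinear_lmul inner_add_left
        inner_add_right algebra_simps add_divide_distrib diff_divide_distrib)
  then have "\<exists>!v. \<forall>z. ?f z = v \<bullet> z"
    by (rule ex_representing_vector)
  moreover have "?f z = v \<bullet> z \<longleftrightarrow> 2 * (v \<bullet> z) = br x y \<bullet> z - br y z \<bullet> x + br z x \<bullet> y" for v z
    by auto
  ultimately have ex: "\<exists>!v. \<forall>z. 2 * (v \<bullet> z) = br x y \<bullet> z - br y z \<bullet> x + br z x \<bullet> y"
    by simp
  show ?thesis unfolding nabla_def using theI'[OF ex] by blast
qed

lemma endo_of_form_inner:
  "blinfun_apply (blinfun_apply \<omega> x) y = endo_of_form \<omega> x \<bullet> y"
proof -
  have 1: "\<exists>!v. \<forall>y. blinfun_apply (blinfun_apply \<omega> x) y = v \<bullet> y" for x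
    by (rule ex_representing_vector)
      (simp add: blinfun.bounded_linear_right bounded_linear.linear)
  have ex: "\<exists>!T. \<forall>x y. blinfun_apply (blinfun_apply \<omega> x) y = T x \<bullet> y"
  proof (rule ex_ex1I)
    show "\<exists>T. \<forall>x y. blinfun_apply (blinfun_apply \<omega> x) y = T x \<bullet> y" using 1 by metis
  next
    fix T T' assume "\<forall>x y. blinfun_apply (blinfun_apply \<omega> x) y = T x \<bullet> y"
      "\<forall>x y. blinfun_apply (blinfun_apply \<omega> x) y = T' x \<bullet> y"
    then show "T = T'" using 1 by (intro ext) metis
  qed
  show ?thesis unfolding endo_of_form_def using theI'[OF ex] by blast
qed

lemma endo_of_form_eqI:
  assumes "\<And>x y. blinfun_apply (blinfun_apply \<omega> x) y = T x \<bullet> y"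
  shows "endo_of_form \<omega> = T"
proof
  fix x
  have "\<forall>y. endo_of_form \<omega> x \<bullet> y = T x \<bullet> y"
    using assms by (simp add: endo_of_form_inner)
  then show "endo_of_form \<omega> x = T x" by (metis vector_eq_rdot)
qed

lemma skew_symmetric_endo_of_form:
  assumes "\<omega> \<in> two_forms"
  shows "skew_symmetric (endo_of_form \<omega>)"
proof -
  let ?T = "endo_of_form \<omega>"
  have T: "?T x \<bullet> y = blinfun_apply (blinfun_apply \<omega> x) y" for x y
    by (simp add: endo_of_form_inner)
  have "linear ?T"
  proof (rule linearI)
    fix x y :: 'a and c :: real
    show "?T (x + y) = ?T x + ?T y"
      by (subst vector_eq_rdot[symmetric]) (simp add: inner_add_left T blinfun.bilinear_simps)
    show "?T (c *\<^sub>R x) = c *\<^sub>R ?T x"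
      by (subst vector_eq_rdot[symmetric]) (simp add: T blinfun.bilinear_simps)
  qed
  moreover have "?T x \<bullet> y = - (x \<bullet> ?T y)" for x y
  proof -
    have alt: "blinfun_apply (blinfun_apply \<omega> u) u = 0" for u
      using assms by (simp add: two_forms_def)
    from alt[of "x + y"] alt[of x] alt[of y] show ?thesis
      by (simp add: blinfun.bilinear_simps T inner_commute[of x])
  qed
  ultimately show ?thesis by (simp add: skew_symmetric_def)
qed

text \<open>The sum below is the negative of the codifferential of \<open>\<omega>\<close>, evaluated at \<open>z\<close>.\<close>

lemma CKY_with_theta:
  fixes br :: "'a::euclidean_space \<Rightarrow> 'a \<Rightarrow> 'a"
  assumes "CKY_with br \<omega> \<theta>"
  shows "(real DIM('a) - 1) * blinfun_apply \<theta> z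
    = (\<Sum>e\<in>Basis. nabla_endo br (endo_of_form \<omega>) e e \<bullet> z)"
proof -
  have e: "nabla_endo br (endo_of_form \<omega>) e e \<bullet> z = blinfun_apply \<theta> z - (z \<bullet> e) * blinfun_apply \<theta> e"
    if "e \<in> Basis" for e
  proof -
    have "nabla_endo br (endo_of_form \<omega>) e e \<bullet> z + nabla_endo br (endo_of_form \<omega>) e e \<bullet> z =
        2 * (e \<bullet> e) * blinfun_apply \<theta> z - (e \<bullet> z) * blinfun_apply \<theta> e
          - (e \<bullet> z) * blinfun_apply \<theta> e"
      using assms by (simp only: CKY_with_def)
    then show ?thesis
      using that by (simp add: inner_same_Basis inner_commute[of e z] mult.commute)
  qed
  have "blinfun_apply \<theta> z = blinfun_apply \<theta> (\<Sum>e\<in>Basis. (z \<bullet> e) *\<^sub>R e)"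
    by (simp add: euclidean_representation)
  also have "\<dots> = (\<Sum>e\<in>Basis. (z \<bullet> e) * blinfun_apply \<theta> e)"
    by (simp add: blinfun.sum_right blinfun.scaleR_right)
  finally show ?thesis by (simp add: e sum_subtractf algebra_simps)
qed

lemma CKY_with_unique:
  fixes br :: "'a::euclidean_space \<Rightarrow> 'a \<Rightarrow> 'a"
  assumes "CKY_with br \<omega> \<theta>" "CKY_with br \<omega> \<theta>'" "DIM('a) \<ge> 2"
  shows "\<theta> = \<theta>'"
proof (rule blinfun_eqI)
  fix z
  have "(real DIM('a) - 1) * blinfun_apply \<theta> z = (real DIM('a) - 1) * blinfun_apply \<theta>' z"
    using CKY_with_theta[OF assms(1), of z] CKY_with_theta[OF assms(2), of z] by simp
  with assms(3) show "blinfun_apply \<theta> z = blinfun_apply \<theta>' z" by simp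
qed

context metric_lie_algebra
begin

lemma linear_nabla: "linear (nabla br x)"
proof (rule linearI)
  have K: "nabla br x y \<bullet> z = (br x y \<bullet> z - br y z \<bullet> x + br z x \<bullet> y) / 2" for y z
    using nabla_koszul[of x y z] by simp
  fix y y' :: 'a and c :: real
  show "nabla br x (y + y') = nabla br x y + nabla br x y'"
    using bilinear_br
    by (subst vector_eq_rdot[symmetric])
      (simp add: inner_add_left inner_add_right K bilinear_ladd bilinear_radd field_simps)
  show "nabla br x (c *\<^sub>R y) = c *\<^sub>R nabla br x y"
    using bilinear_br
    by (subst vector_eq_rdot[symmetric])
      (simp add: K bilinear_lmul bilinear_rmul algebra_simps)
qed

lemma CKY_with_zero: "CKY_with br 0 0"
proof -
  have "endo_of_form 0 = (\<lambda>x. 0 :: 'a)" by (rule endo_of_form_eqI) simp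
  then show ?thesis
    by (simp add: CKY_with_def two_forms_def nabla_endo_def linear_0[OF linear_nabla])
qed

lemma CKY_with_add:
  assumes "CKY_with br \<omega> \<theta>" "CKY_with br \<omega>' \<theta>'"
  shows "CKY_with br (\<omega> + \<omega>') (\<theta> + \<theta>')"
proof -
  have E: "endo_of_form (\<omega> + \<omega>') = (\<lambda>x. endo_of_form \<omega> x + endo_of_form \<omega>' x)"
    by (rule endo_of_form_eqI)
      (simp add: blinfun.bilinear_simps endo_of_form_inner inner_add_left)
  have N: "nabla_endo br (endo_of_form (\<omega> + \<omega>')) x y
      = nabla_endo br (endo_of_form \<omega>) x y + nabla_endo br (endo_of_form \<omega>') x y" for x y
    by (simp add: nabla_endo_def E linear_add[OF linear_nabla])
  show ?thesis
    unfolding CKY_with_def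
  proof (intro conjI allI)
    show "\<omega> + \<omega>' \<in> two_forms"
      using assms by (simp add: CKY_with_def two_forms_def blinfun.bilinear_simps)
    fix x y z
    have "nabla_endo br (endo_of_form \<omega>) x y \<bullet> z + nabla_endo br (endo_of_form \<omega>) y x \<bullet> z =
        2 * (x \<bullet> y) * blinfun_apply \<theta> z - (y \<bullet> z) * blinfun_apply \<theta> x
          - (x \<bullet> z) * blinfun_apply \<theta> y"
      "nabla_endo br (endo_of_form \<omega>') x y \<bullet> z + nabla_endo br (endo_of_form \<omega>') y x \<bullet> z =
        2 * (x \<bullet> y) * blinfun_apply \<theta>' z - (y \<bullet> z) * blinfun_apply \<theta>' x
          - (x \<bullet> z) * blinfun_apply \<theta>' y"
      using assms by (simp_all only: CKY_with_def)
    then show "nabla_endo br (endo_of_form (\<omega> + \<omega>')) x y \<bullet> z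
        + nabla_endo br (endo_of_form (\<omega> + \<omega>')) y x \<bullet> z =
        2 * (x \<bullet> y) * blinfun_apply (\<theta> + \<theta>') z - (y \<bullet> z) * blinfun_apply (\<theta> + \<theta>') x
          - (x \<bullet> z) * blinfun_apply (\<theta> + \<theta>') y"
      by (simp add: N inner_add_left blinfun.bilinear_simps algebra_simps)
  qed
qed

lemma CKY_with_scale:
  assumes "CKY_with br \<omega> \<theta>"
  shows "CKY_with br (c *\<^sub>R \<omega>) (c *\<^sub>R \<theta>)"
proof -
  have E: "endo_of_form (c *\<^sub>R \<omega>) = (\<lambda>x. c *\<^sub>R endo_of_form \<omega> x)"
    by (rule endo_of_form_eqI) (simp add: blinfun.bilinear_simps endo_of_form_inner)
  have N: "nabla_endo br (endo_of_form (c *\<^sub>R \<omega>)) x y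
      = c *\<^sub>R nabla_endo br (endo_of_form \<omega>) x y" for x y
    by (simp add: nabla_endo_def E linear_scale[OF linear_nabla] scaleR_diff_right)
  show ?thesis
    unfolding CKY_with_def
  proof (intro conjI allI)
    show "c *\<^sub>R \<omega> \<in> two_forms"
      using assms by (simp add: CKY_with_def two_forms_def blinfun.bilinear_simps)
    fix x y z
    have "c * (nabla_endo br (endo_of_form \<omega>) x y \<bullet> z + nabla_endo br (endo_of_form \<omega>) y x \<bullet> z) =
        c * (2 * (x \<bullet> y) * blinfun_apply \<theta> z - (y \<bullet> z) * blinfun_apply \<theta> x
          - (x \<bullet> z) * blinfun_apply \<theta> y)"
      using assms by (simp only: CKY_with_def)
    then show "nabla_endo br (endo_of_form (c *\<^sub>R \<omega>)) x y \<bullet> z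
        + nabla_endo br (endo_of_form (c *\<^sub>R \<omega>)) y x \<bullet> z =
        2 * (x \<bullet> y) * blinfun_apply (c *\<^sub>R \<theta>) z - (y \<bullet> z) * blinfun_apply (c *\<^sub>R \<theta>) x
          - (x \<bullet> z) * blinfun_apply (c *\<^sub>R \<theta>) y"
      by (simp add: N blinfun.bilinear_simps algebra_simps)
  qed
qed

lemma subspace_CKY2: "subspace (CKY2 br)"
  unfolding CKY2_def subspace_def
  using CKY_with_zero CKY_with_add CKY_with_scale by blast

lemma subspace_KY2: "subspace (KY2 br)"
  unfolding KY2_def subspace_def
  using CKY_with_zero CKY_with_add[of _ 0 _ 0] CKY_with_scale[of _ 0] by simp

lemma subspace_starKY2: "subspace (starKY2 br)"
proof -
  have "ext_deriv br 0 x y z = 0" for x y z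
    by (simp add: ext_deriv_def)
  moreover have "ext_deriv br (\<omega> + \<omega>') x y z = ext_deriv br \<omega> x y z + ext_deriv br \<omega>' x y z"
    for \<omega> \<omega>' x y z
    by (simp add: ext_deriv_def blinfun.bilinear_simps)
  moreover have "ext_deriv br (c *\<^sub>R \<omega>) x y z = c * ext_deriv br \<omega> x y z" for c \<omega> x y z
    by (simp add: ext_deriv_def blinfun.bilinear_simps algebra_simps)
  ultimately show ?thesis
    using subspace_CKY2 unfolding starKY2_def subspace_def by simp
qed

end

end

theory Submission
  imports Defs
begin

text \<open>
  Normalise \<open>\<xi>\<close> to a unit vector.  Since \<open>\<xi>\<close> is central, \<open>A = nabla \<xi>\<close> satisfies
  \<open>nabla x \<xi> = A x\<close>, and the conformal Killing-Yano equation of \<open>T\<close> gives \<open>T \<xi> = 0\<close> and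
  \<open>A T = T A = id\<close> on the four-dimensional complement \<open>h\<close> of \<open>\<xi>\<close>.  On \<open>h\<close> the tensor \<open>T\<close> is Killing-Yano and
  invertible, and splitting \<open>h\<close> into eigenplanes of \<open>T\<^sup>2\<close> shows that it is parallel for the induced
  connection \<open>D\<close>; hence \<open>T\<close> is closed.

  Given another conformal Killing-Yano tensor \<open>S\<close> with vector \<open>\<eta>\<close>, subtract a multiple of \<open>T\<close> to achieve
  \<open>\<eta> \<bottom> \<xi>\<close>, and put \<open>v = S \<xi>\<close>.  The compression \<open>S'\<close> of \<open>S\<close> to \<open>h\<close> satisfies
  \<open>D\<^sub>x v = 2 S' A x - A S' x\<close>, and the symmetrisation of \<open>D S'\<close> is an explicit expression in \<open>v\<close> and
  \<open>A\<close>.  If \<open>T\<^sup>2\<close> has two distinct eigenvalues on \<open>h\<close>, then \<open>D\<close> acts on each eigenplane by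
  rotations, which forces \<open>v = 0\<close>.  If \<open>A\<^sup>2\<close> is scalar on \<open>h\<close> and \<open>v\<close> is nonzero, then
  \<open>v, A v, S' A v, A S' A v\<close> is an orthogonal basis of \<open>h\<close>, and the values of \<open>D S'\<close> on it contradict each
  other.  Finally \<open>v = 0\<close> gives \<open>2 S' A = A S'\<close>, which together with its transpose \<open>2 A S' = S' A\<close>
  implies \<open>S' = 0\<close>.
\<close>

section \<open>Linear algebra: orthogonal frames and skew-symmetric endomorphisms\<close>

text \<open>Orthogonal nonzero vectors are independent, so five of them span the space and
  \<open>x\<close> is orthogonal to itself.\<close>

lemma orthogonal_frame_separates:
  fixes x :: "'a::euclidean_space"
  assumes "DIM('a) = 5"
    and "p \<noteq> 0" "q \<noteq> 0" "r \<noteq> 0" "s \<noteq> 0" "t \<noteq> 0"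
    and "p \<bullet> q = 0" "p \<bullet> r = 0" "p \<bullet> s = 0" "p \<bullet> t = 0" "q \<bullet> r = 0" "q \<bullet> s = 0" "q \<bullet> t = 0"
      "r \<bullet> s = 0" "r \<bullet> t = 0" "s \<bullet> t = 0"
    and "x \<bullet> p = 0" "x \<bullet> q = 0" "x \<bullet> r = 0" "x \<bullet> s = 0" "x \<bullet> t = 0"
  shows "x = 0"
proof -
  let ?B = "{p, q, r, s, t}"
  have orth: "pairwise orthogonal ?B"
    using assms by (auto simp: pairwise_insert orthogonal_def inner_commute)
  have "0 \<notin> ?B" using assms by auto
  then have ind: "independent ?B"
    using orth by (rule pairwise_orthogonal_independent[rotated])
  have ne: "p \<noteq> q" "p \<noteq> r" "p \<noteq> s" "p \<noteq> t" "q \<noteq> r" "q \<noteq> s" "q \<noteq> t" "r \<noteq> s" "r \<noteq> t" "s \<noteq> t"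
    using assms(2-16) by auto
  have "card ?B = 5" using ne by simp
  then have "UNIV \<subseteq> span ?B"
    using ind assms(1) by (intro card_ge_dim_independent) auto
  then have "orthogonal x x"
    using assms(17-) by (intro orthogonal_to_span[of x ?B x]) (auto simp: orthogonal_def)
  then show ?thesis by (simp add: orthogonal_self)
qed

lemma skew_symmetric_inner: "skew_symmetric S \<Longrightarrow> S x \<bullet> y = - (x \<bullet> S y)"
  unfolding skew_symmetric_def by blast

lemma skew_symmetric_linear: "skew_symmetric S \<Longrightarrow> linear S"
  unfolding skew_symmetric_def by blast

lemma skew_symmetric_inner_self: "skew_symmetric S \<Longrightarrow> S x \<bullet> x = 0" "skew_symmetric S \<Longrightarrow> x \<bullet> S x = 0"
  using skew_symmetric_inner[of S x x] by (simp_all add: inner_commute)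

lemma exists_orthogonal_vector:
  fixes B :: "'a::euclidean_space set"
  assumes "finite B" "card B < DIM('a)"
  obtains x where "x \<noteq> 0" "\<And>y. y \<in> B \<Longrightarrow> x \<bullet> y = 0"
proof -
  have "dim B < DIM('a)"
    using dim_le_card'[OF assms(1)] assms(2) by linarith
  then have "span B \<noteq> UNIV"
    by (metis dim_UNIV dim_span less_irrefl)
  then obtain x where "x \<noteq> 0" "\<forall>y\<in>span B. x \<bullet> y = 0"
    using span_not_UNIV_orthogonal by blast
  then show thesis using that span_base by blast
qed

text \<open>The eigenvector of \<open>T\<^sup>2\<close> maximises \<open>norm (T x)\<close> on the unit sphere.\<close>

lemma skew_symmetric_square_eigenvector:
  fixes T :: "'a::euclidean_space \<Rightarrow> 'a"
  assumes T: "skew_symmetric T" and kernel: "T \<xi> = 0" and dim: "DIM('a) \<ge> 2"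
  obtains p m where "p \<noteq> 0" "p \<bullet> \<xi> = 0" "T (T p) = - (m *\<^sub>R p)"
proof -
  note lin = skew_symmetric_linear[OF T]
  define K where "K = sphere (0::'a) 1 \<inter> {x. \<xi> \<bullet> x = 0}"
  have "compact K"
    unfolding K_def by (intro compact_Int_closed compact_sphere closed_hyperplane)
  moreover have "K \<noteq> {}"
  proof -
    obtain x where "x \<noteq> 0" "x \<bullet> \<xi> = 0"
      using exists_orthogonal_vector[of "{\<xi>}"] dim by auto
    then have "x /\<^sub>R norm x \<in> K" by (simp add: K_def inner_commute)
    then show ?thesis by blast
  qed
  moreover have "continuous_on K (\<lambda>x. norm (T x))"
    using lin by (intro continuous_on_norm linear_continuous_on linear_conv_bounded_linear[THEN iffD1])
  ultimately obtain p where p: "p \<in> K" and max: "\<And>x. x \<in> K \<Longrightarrow> norm (T x) \<le> norm (T p)"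
    using continuous_attains_sup[of K "\<lambda>x. norm (T x)"] by blast
  have p1: "p \<bullet> p = 1" "p \<bullet> \<xi> = 0" "p \<noteq> 0"
    using p by (auto simp: K_def dot_square_norm inner_commute)
  define m where "m = T p \<bullet> T p"
  have bound: "T y \<bullet> T y \<le> m * (y \<bullet> y)" if "y \<bullet> \<xi> = 0" for y
  proof (cases "y = 0")
    case True then show ?thesis by (simp add: linear_0[OF lin])
  next
    case False
    then have "y /\<^sub>R norm y \<in> K" using that by (simp add: K_def inner_commute)
    then have "norm (T (y /\<^sub>R norm y)) \<le> norm (T p)" by (rule max)
    then have "norm (T y) \<le> norm (T p) * norm y"
      using False by (simp add: linear_scale[OF lin] field_simps)
    then have "(norm (T y))\<^sup>2 \<le> (norm (T p) * norm y)\<^sup>2"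
      by (rule power_mono) simp
    then show ?thesis by (simp add: m_def dot_square_norm power_mult_distrib)
  qed
  \<comment> \<open>First-order condition at the maximum: moving \<open>p\<close> in the direction
    \<open>y\<close> must respect \<open>bound\<close> for every step size \<open>t\<close>.\<close>
  have crit: "T p \<bullet> T y = m * (p \<bullet> y)" if y: "y \<bullet> \<xi> = 0" for y
  proof -
    define l where "l = T p \<bullet> T y - m * (p \<bullet> y)"
    define r where "r = m * (y \<bullet> y) - T y \<bullet> T y"
    have ineq: "2 * t * l \<le> t\<^sup>2 * r" for t
    proof -
      have "(p + t *\<^sub>R y) \<bullet> \<xi> = 0" using p1 y by (simp add: inner_add_left)
      from bound[OF this] show ?thesis
        by (simp add: linear_add[OF lin] linear_scale[OF lin] inner_add_left inner_add_right
            m_def[symmetric] l_def r_def p1 inner_commute[of "T y" "T p"] inner_commute[of y p]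
            power2_eq_square algebra_simps)
    qed
    have "r \<ge> 0" using bound[OF y] by (simp add: r_def)
    \<comment> \<open>A step proportional to \<open>l\<close> makes the left side quadratic in
      \<open>l\<close>; the summand 1 keeps the denominator positive when
      \<open>r = 0\<close>.\<close>
    have "2 * (l / (r + 1)) * l \<le> (l / (r + 1))\<^sup>2 * r" by (rule ineq)
    then have "2 * l\<^sup>2 * (r + 1) \<le> l\<^sup>2 * r"
      using \<open>r \<ge> 0\<close> by (simp add: divide_simps power2_eq_square split: if_splits)
    then have "l\<^sup>2 * (r + 2) \<le> 0" by (simp add: algebra_simps)
    then have "l = 0" using \<open>r \<ge> 0\<close> by (simp add: mult_le_0_iff)
    then show ?thesis by (simp add: l_def)
  qed
  have "(T (T p) + m *\<^sub>R p) \<bullet> y = 0" for y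
  proof (cases "\<xi> = 0")
    case True
    then show ?thesis using crit[of y] by (simp add: inner_add_left skew_symmetric_inner[OF T, of "T p"])
  next
    case False
    \<comment> \<open>\<open>crit\<close> needs a vector orthogonal to \<xi>. The discarded
      component contributes nothing, since \<open>T \<xi> = 0\<close> and \<open>p\<close> is
      orthogonal to \<xi>.\<close>
    define y' where "y' = y - ((y \<bullet> \<xi>) / (\<xi> \<bullet> \<xi>)) *\<^sub>R \<xi>"
    have "y' \<bullet> \<xi> = 0" using False by (simp add: y'_def inner_diff_left)
    from crit[OF this] show ?thesis
      by (simp add: y'_def inner_add_left skew_symmetric_inner[OF T, of "T p"] inner_diff_right p1
          linear_diff[OF lin] linear_scale[OF lin] kernel)
  qed
  then have "T (T p) + m *\<^sub>R p = 0" by (metis inner_eq_zero_iff)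
  then have "T (T p) = - (m *\<^sub>R p)" by (simp add: add_eq_0_iff2)
  then show thesis using that p1 by blast
qed

text \<open>An eigenvector \<open>p\<close> of the square of \<open>T\<close> spans with
  \<open>T p\<close> an invariant plane. Only a second plane remains beside it and \<xi>, so any
  nonzero \<open>q\<close> orthogonal to \<xi>, \<open>p\<close> and \<open>T p\<close> is an
  eigenvector too.\<close>

lemma skew_symmetric_adapted_frame:
  fixes T :: "'a::euclidean_space \<Rightarrow> 'a"
  assumes dim: "DIM('a) = 5" and T: "skew_symmetric T" and kernel: "T \<xi> = 0" and "\<xi> \<noteq> 0"
    and inj: "\<And>x. x \<bullet> \<xi> = 0 \<Longrightarrow> T x = 0 \<Longrightarrow> x = 0"
  obtains p q m n where "p \<bullet> \<xi> = 0" "q \<bullet> \<xi> = 0" "T (T p) = - (m *\<^sub>R p)" "T (T q) = - (n *\<^sub>R q)"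
    "m \<noteq> 0" "n \<noteq> 0"
    "\<And>x. x \<bullet> \<xi> = 0 \<Longrightarrow> x \<bullet> p = 0 \<Longrightarrow> x \<bullet> T p = 0 \<Longrightarrow> x \<bullet> q = 0 \<Longrightarrow> x \<bullet> T q = 0 \<Longrightarrow> x = 0"
proof -
  note lin = skew_symmetric_linear[OF T]
  note [simp] = skew_symmetric_inner_self[OF T]
  have T_horizontal: "T x \<bullet> \<xi> = 0" for x
    by (simp add: skew_symmetric_inner[OF T, of x \<xi>] kernel)
  obtain p m where p: "p \<noteq> 0" "p \<bullet> \<xi> = 0" "T (T p) = - (m *\<^sub>R p)"
    using skew_symmetric_square_eigenvector[OF T kernel] dim by auto
  have "card {\<xi>, p, T p} < 5"
    by (rule le_less_trans[OF card_insert_le_m1[of 3]]) (simp_all add: card_insert_if)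
  then obtain q where q: "q \<noteq> 0" "q \<bullet> \<xi> = 0" "q \<bullet> p = 0" "q \<bullet> T p = 0"
    using exists_orthogonal_vector[of "{\<xi>, p, T p}"] dim by (metis finite.emptyI finite.insertI insertCI)
  have Tq: "T q \<bullet> p = 0" "T q \<bullet> T p = 0"
    using q by (simp_all add: skew_symmetric_inner[OF T, of q] p)
  have nz: "T p \<noteq> 0" "T q \<noteq> 0" using inj p q by blast+
  have separates: "x = 0"
    if "x \<bullet> \<xi> = 0" "x \<bullet> p = 0" "x \<bullet> T p = 0" "x \<bullet> q = 0" "x \<bullet> T q = 0" for x
    by (rule orthogonal_frame_separates[OF dim, of \<xi> p "T p" q "T q"])
      (use that p q Tq nz T_horizontal \<open>\<xi> \<noteq> 0\<close> in \<open>simp_all add: inner_commute\<close>)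
  \<comment> \<open>This value makes \<open>T (T q) + n *\<^sub>R q\<close> orthogonal to
    \<open>q\<close>, the one frame condition that is not automatic.\<close>
  define n where "n = (T q \<bullet> T q) / (q \<bullet> q)"
  have "T (T q) + n *\<^sub>R q = 0"
    by (rule separates)
      (use p q Tq T_horizontal in \<open>simp_all add: inner_add_left skew_symmetric_inner[OF T, of "T q"] n_def\<close>)
  then have "T (T q) = - (n *\<^sub>R q)" by (simp add: add_eq_0_iff2)
  moreover have "m \<noteq> 0"
    using inj[of "T p"] p nz T_horizontal by auto
  moreover have "n \<noteq> 0" using q nz by (simp add: n_def)
  ultimately show thesis using that p q separates by blast
qed

section \<open>The reduced equations on the complement of \<xi>\<close>

text \<open>The data that a conformal Killing-Yano endomorphism induces on the orthogonal complement of a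
  central unit vector \<open>\<xi>\<close>, see \<open>reduced_cky_compression\<close>.\<close>

locale reduced_cky =
  fixes \<xi> v :: "'a::euclidean_space" and D :: "'a \<Rightarrow> 'a \<Rightarrow> 'a" and A S :: "'a \<Rightarrow> 'a"
  assumes dim5: "DIM('a) = 5" and \<xi>_nonzero: "\<xi> \<noteq> 0"
    and skew_D: "\<And>x. skew_symmetric (D x)" and skew_A: "skew_symmetric A" and skew_S: "skew_symmetric S"
    and A_\<xi>: "A \<xi> = 0" and S_\<xi>: "S \<xi> = 0" and v_horizontal: "v \<bullet> \<xi> = 0"
    and D_A: "\<And>x y. D x (A y) = A (D x y)"
    and D_v: "\<And>x. D x v = 2 *\<^sub>R S (A x) - A (S x)"
    and symmetrized_D_S: "\<And>x y z. x \<bullet> \<xi> = 0 \<Longrightarrow> y \<bullet> \<xi> = 0 \<Longrightarrow> z \<bullet> \<xi> = 0 \<Longrightarrow>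
      D x (S y) \<bullet> z + D x y \<bullet> S z + (D y (S x) \<bullet> z + D y x \<bullet> S z) =
        (y \<bullet> v) * (A x \<bullet> z) + (x \<bullet> v) * (A y \<bullet> z) + 2 * (x \<bullet> y) * (A v \<bullet> z)
        - (A v \<bullet> x) * (y \<bullet> z) - (A v \<bullet> y) * (x \<bullet> z)"
begin

lemmas linear_D = skew_symmetric_linear[OF skew_D]
lemmas linear_A = skew_symmetric_linear[OF skew_A]
lemmas linear_S = skew_symmetric_linear[OF skew_S]
lemmas inner_self_simps = skew_symmetric_inner_self[OF skew_D] skew_symmetric_inner_self[OF skew_A]
  skew_symmetric_inner_self[OF skew_S]

lemma A_horizontal: "A x \<bullet> \<xi> = 0"
  using skew_symmetric_inner[OF skew_A, of x \<xi>] by (simp add: A_\<xi>)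

lemma S_horizontal: "S x \<bullet> \<xi> = 0"
  using skew_symmetric_inner[OF skew_S, of x \<xi>] by (simp add: S_\<xi>)

text \<open>\<open>D p\<close> maps the plane of \<open>p\<close> and \<open>A p\<close> to itself
  as an infinitesimal rotation, so in \<open>symmetrized_D_S\<close> at \<open>(p, p, A p)\<close>
  the left side vanishes and the right side is a multiple of
  \<open>k * (p \<bullet> p) * (p \<bullet> v)\<close>.\<close>

lemma v_orthogonal_to_parallel_plane:
  assumes p: "p \<noteq> 0" "p \<bullet> \<xi> = 0" "A (A p) = - (k *\<^sub>R p)" "k \<noteq> 0" and plane: "D p p = c *\<^sub>R A p"
  shows "v \<bullet> p = 0"
proof -
  have "D p (A p) = - ((c * k) *\<^sub>R p)"
    by (simp add: D_A plane linear_scale[OF linear_A] p)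
  then have "D p (S p) \<bullet> A p = 0"
    by (simp add: skew_symmetric_inner[OF skew_D] inner_self_simps)
  moreover have "D p p \<bullet> S (A p) = 0" by (simp add: plane inner_self_simps)
  moreover have "A p \<bullet> A p = k * (p \<bullet> p)" "A v \<bullet> A p = k * (p \<bullet> v)"
    by (simp_all add: skew_symmetric_inner[OF skew_A, of _ "A p"] p inner_commute[of v])
  ultimately have "k * (p \<bullet> p) * (p \<bullet> v) = 0"
    using symmetrized_D_S[OF p(2,2) A_horizontal, of p] by (simp add: inner_self_simps algebra_simps)
  then show ?thesis using p by (simp add: inner_commute)
qed

text \<open>\<open>D x v\<close> is orthogonal to \<open>v\<close>; inserting \<open>D_v\<close> and
  moving all operators away from \<open>x\<close> gives the identity.\<close>

lemma v_A_S_relation: "S (A v) = 2 *\<^sub>R A (S v)"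
proof -
  have "(2 *\<^sub>R A (S v) - S (A v)) \<bullet> x = D x v \<bullet> v" for x
    by (simp add: D_v inner_diff_left inner_diff_right skew_symmetric_inner[OF skew_A, of x]
        skew_symmetric_inner[OF skew_A, of "S x"] skew_symmetric_inner[OF skew_S, of "A x"]
        skew_symmetric_inner[OF skew_S, of x] inner_commute[of _ x])
  then have "(2 *\<^sub>R A (S v) - S (A v)) \<bullet> x = 0" for x
    by (simp add: inner_self_simps)
  then have "2 *\<^sub>R A (S v) - S (A v) = 0" by (metis inner_eq_zero_iff)
  then show ?thesis by simp
qed

text \<open>For nonzero \<open>v\<close>, three instances of \<open>symmetrized_D_S\<close> are
  incompatible: \<open>(v, v, w)\<close> fixes the length of \<open>u\<close>,
  \<open>(u, u, w)\<close> fixes \<open>s * s\<close>, and \<open>(v, u, A u)\<close> then forces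
  \<open>(w \<bullet> w) * (u \<bullet> u) = 0\<close>.\<close>

lemma v_eq_0_if_A_square_scalar:
  assumes k: "k \<noteq> 0" and A2: "\<And>x. x \<bullet> \<xi> = 0 \<Longrightarrow> A (A x) = - (k *\<^sub>R x)"
  shows "v = 0"
proof (rule ccontr)
  assume v: "v \<noteq> 0"
  note D_skew = skew_symmetric_inner[OF skew_D] and A_skew = skew_symmetric_inner[OF skew_A]
    and S_skew = skew_symmetric_inner[OF skew_S]
  note horizontal = v_horizontal A_horizontal S_horizontal
  define w where "w = A v"
  define u where "u = S w"
  have A2_simps: "A (A v) = - (k *\<^sub>R v)" "A (A (S x)) = - (k *\<^sub>R S x)" "A (A u) = - (k *\<^sub>R u)" for x
    by (simp_all add: A2 u_def horizontal)
  have Aw: "A w = - (k *\<^sub>R v)" by (simp add: w_def A2_simps)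
  have u: "u = 2 *\<^sub>R A (S v)" by (simp add: u_def w_def v_A_S_relation)
  have "A u = - ((2 * k) *\<^sub>R S v)" by (simp add: u linear_scale[OF linear_A] A2_simps)
  then have Sv: "S v = - ((1 / (2 * k)) *\<^sub>R A u)" using k by simp
  have ww: "w \<bullet> w = k * (v \<bullet> v)" using A_skew[of v w] by (simp add: w_def A2_simps)
  have AuAu: "A u \<bullet> A u = k * (u \<bullet> u)" using A_skew[of u "A u"] by (simp add: A2_simps)
  have vw: "v \<bullet> w = 0" by (simp add: w_def inner_self_simps)
  have uw: "u \<bullet> w = 0" by (simp add: u_def inner_self_simps)
  \<comment> \<open>The two descriptions of \<open>u\<close>, as \<open>S w\<close> and as
    \<open>2 *\<^sub>R A (S v)\<close>, give values that differ by a factor 2.\<close>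
  have uv: "u \<bullet> v = 0"
  proof -
    have "u \<bullet> v = - 2 * (S v \<bullet> w)" by (simp add: u A_skew w_def)
    moreover have "u \<bullet> v = - (S v \<bullet> w)" by (simp add: u_def S_skew[of w] inner_commute[of w])
    ultimately show ?thesis by simp
  qed
  have Au: "A u \<bullet> v = 0" "A u \<bullet> w = 0" "A u \<bullet> u = 0"
    using A_skew[of u v] A_skew[of u w] uw uv by (simp_all add: w_def A2_simps inner_self_simps)
  have orth: "w \<bullet> v = 0" "w \<bullet> u = 0" "v \<bullet> u = 0" "v \<bullet> A u = 0" "w \<bullet> A u = 0" "u \<bullet> A u = 0"
    using vw uw uv Au by (simp_all add: inner_commute)
  note orth = orth vw uw uv Au
  have u_horizontal: "u \<bullet> \<xi> = 0" and w_horizontal: "w \<bullet> \<xi> = 0"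
    by (simp_all add: u_def w_def horizontal)
  note horizontal = horizontal u_horizontal w_horizontal
  have D_v_v: "D v v = (3 / 2) *\<^sub>R u"
  proof -
    have "D v v = 4 *\<^sub>R A (S v) - 1 *\<^sub>R A (S v)"
      by (simp add: D_v w_def[symmetric] u_def[symmetric]) (simp add: u)
    then show ?thesis unfolding scaleR_left_diff_distrib[symmetric] by (simp add: u)
  qed
  have D_v_w: "D v w = (3 / 2) *\<^sub>R A u"
    by (simp add: w_def D_A D_v_v linear_scale[OF linear_A])
  have pos: "w \<noteq> 0" "v \<bullet> v \<noteq> 0" using v k ww by auto
  have uu: "u \<bullet> u = (8 / 9) * (v \<bullet> v) * (w \<bullet> w)"
  proof -
    have 1: "D v (S v) \<bullet> w = (3 / 4) * (u \<bullet> u)"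
      using k by (simp add: D_skew D_v_w) (simp add: Sv AuAu)
    have 2: "D v v \<bullet> S w = (3 / 2) * (u \<bullet> u)"
      by (simp add: D_v_v u_def[symmetric])
    show ?thesis
      using symmetrized_D_S[of v v w] 1 2
      by (simp add: horizontal w_def[symmetric] orth)
  qed
  then have unz: "u \<noteq> 0" using pos by auto
  have Aunz: "A u \<noteq> 0" using AuAu unz k by auto
  have separates: "x = y" if "x \<bullet> \<xi> = y \<bullet> \<xi>" "x \<bullet> v = y \<bullet> v" "x \<bullet> w = y \<bullet> w" "x \<bullet> u = y \<bullet> u" "x \<bullet> A u = y \<bullet> A u" for x y
  proof -
    have "x - y = 0"
      by (rule orthogonal_frame_separates[OF dim5, of \<xi> v w u "A u"])
        (use that v pos unz Aunz \<xi>_nonzero horizontal orth in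
          \<open>simp_all add: inner_diff_left inner_commute[of \<xi>]\<close>)
    then show ?thesis by simp
  qed
  \<comment> \<open>The component of \<open>S u\<close> along \<open>A u\<close> is the only one not
    determined by the relations so far; it enters \<open>S (A u)\<close> and \<open>A (S u)\<close>
    alike.\<close>
  define s where "s = (S u \<bullet> A u) / (u \<bullet> u)"
  have SuAu: "S u \<bullet> A u = s * (u \<bullet> u)" using unz by (simp add: s_def)
  have Suw: "S u \<bullet> w = - (u \<bullet> u)" by (simp add: S_skew u_def)
  have SAuv: "S (A u) \<bullet> v = (u \<bullet> u) / 2" using k by (simp add: S_skew Sv AuAu)
  have SAuu: "S (A u) \<bullet> u = - s * (u \<bullet> u)" using SuAu S_skew[of "A u" u] by (simp add: inner_commute[of "A u"])
  have SAuw: "S (A u) \<bullet> w = 0" by (simp add: S_skew u_def[symmetric] orth)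
  have ASuv: "A (S u) \<bullet> v = u \<bullet> u" using Suw by (simp add: A_skew w_def[symmetric])
  have ASuu: "A (S u) \<bullet> u = - s * (u \<bullet> u)" using SuAu by (simp add: A_skew)
  have ASuw: "A (S u) \<bullet> w = 0" by (simp add: A_skew Aw S_skew Sv orth)
  have ASuAu: "A (S u) \<bullet> A u = 0" by (simp add: A_skew A2_simps inner_self_simps)
  have SAu: "S (A u) = (4 / 9 * (w \<bullet> w)) *\<^sub>R v - s *\<^sub>R u"
    by (rule separates)
      (simp_all add: SAuv SAuu SAuw inner_diff_left horizontal orth inner_self_simps uu)
  have ASu: "A (S u) = (8 / 9 * (w \<bullet> w)) *\<^sub>R v - s *\<^sub>R u"
    by (rule separates)
      (simp_all add: ASuv ASuu ASuw ASuAu inner_diff_left horizontal orth uu)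
  have D_u_v: "D u v = - (s *\<^sub>R u)"
    by (simp add: D_v SAu ASu scaleR_right_diff_distrib) (simp flip: scaleR_left_diff_distrib)
  have D_u_w: "D u w = - (s *\<^sub>R A u)"
    by (simp add: w_def D_A D_u_v linear_neg[OF linear_A] linear_scale[OF linear_A])
  have ss: "s * s = w \<bullet> w"
  proof -
    have "D u (S u) \<bullet> w = s * s * (u \<bullet> u)" by (simp add: D_skew D_u_w SuAu)
    moreover have "D u u \<bullet> S w = 0" by (simp add: u_def[symmetric] inner_self_simps)
    ultimately have "s * s * (u \<bullet> u) = (u \<bullet> u) * (w \<bullet> w)"
      using symmetrized_D_S[OF u_horizontal u_horizontal w_horizontal]
      by (simp add: w_def[symmetric] orth)
    then show ?thesis using unz by simp
  qed
  have C_uv: "D u (S v) \<bullet> A u + D u v \<bullet> S (A u) = s * s * (u \<bullet> u)"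
    using SAuu by (simp add: D_u_v Sv linear_neg[OF linear_D] linear_scale[OF linear_D] inner_self_simps
        inner_commute)
  \<comment> \<open>\<open>D v u\<close> itself is not computed. Commuting \<open>D v\<close> with
    \<open>A\<close> pairs it only with \<open>v\<close> and \<open>u\<close>: the first value comes
    from \<open>D_v_v\<close>, the second is zero by skewness.\<close>
  have C_vu: "D v (S u) \<bullet> A u + D v u \<bullet> S (A u) = - 2 * (w \<bullet> w) * (u \<bullet> u)"
  proof -
    have "D v (S u) \<bullet> A u = D v u \<bullet> A (S u)"
      by (simp add: D_skew[of v "S u"] D_A inner_commute[of "S u"]) (simp add: A_skew)
    moreover have "D v u \<bullet> v = - (3 / 2) * (u \<bullet> u)" by (simp add: D_skew D_v_v)
    ultimately show ?thesis
      by (simp add: SAu ASu inner_diff_right inner_self_simps)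
  qed
  have "(w \<bullet> w) * (u \<bullet> u) = 0"
    using symmetrized_D_S[OF v_horizontal u_horizontal A_horizontal, of u] C_uv C_vu ss
    by (auto simp: orth uv AuAu ww w_def[symmetric])
  then show False using pos unz by simp
qed

end

section \<open>The equation for endomorphisms and the Levi-Civita connection\<close>

text \<open>The conformal Killing-Yano equation for an endomorphism, with the covariant derivatives
  expanded by skew-symmetry.\<close>

definition cky_endo :: "('a::euclidean_space \<Rightarrow> 'a \<Rightarrow> 'a) \<Rightarrow> ('a \<Rightarrow> 'a) \<Rightarrow> 'a \<Rightarrow> bool" where
  "cky_endo br S \<eta> \<longleftrightarrow> skew_symmetric S \<and>
     (\<forall>x y z. nabla br x (S y) \<bullet> z + nabla br x y \<bullet> S z + (nabla br y (S x) \<bullet> z + nabla br y x \<bullet> S z) =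
        2 * (x \<bullet> y) * (\<eta> \<bullet> z) - (y \<bullet> z) * (\<eta> \<bullet> x) - (x \<bullet> z) * (\<eta> \<bullet> y))"

lemma nabla_endo_inner:
  assumes "skew_symmetric S"
  shows "nabla_endo br S x y \<bullet> z = nabla br x (S y) \<bullet> z + nabla br x y \<bullet> S z"
  by (simp add: nabla_endo_def inner_diff_left skew_symmetric_inner[OF assms])

lemma cky_endo_endo_of_form:
  assumes "CKY_with br \<omega> \<theta>" "\<And>x. blinfun_apply \<theta> x = \<eta> \<bullet> x"
  shows "cky_endo br (endo_of_form \<omega>) \<eta>"
proof -
  have skew: "skew_symmetric (endo_of_form \<omega>)"
    using assms(1) by (intro skew_symmetric_endo_of_form) (simp add: CKY_with_def)
  show ?thesis
    using assms(1) skew by (simp add: CKY_with_def cky_endo_def assms(2) nabla_endo_inner[OF skew])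
qed

lemma cky_endo_diff_scaleR:
  assumes br: "metric_lie_algebra br" and "cky_endo br S \<eta>" "cky_endo br T \<xi>"
  shows "cky_endo br (\<lambda>x. S x - c *\<^sub>R T x) (\<eta> - c *\<^sub>R \<xi>)"
proof -
  note S = assms(2)[unfolded cky_endo_def] and T = assms(3)[unfolded cky_endo_def]
  note lin = metric_lie_algebra.linear_nabla[OF br]
  have "linear S" "linear T" using S T by (simp_all add: skew_symmetric_linear)
  then have "linear (\<lambda>x. S x - c *\<^sub>R T x)"
    by (intro linear_compose_sub linear_compose_scale_right)
  moreover have "(S x - c *\<^sub>R T x) \<bullet> y = - (x \<bullet> (S y - c *\<^sub>R T y))" for x y
    using S T by (simp add: inner_diff_left inner_diff_right skew_symmetric_inner)
  ultimately have "skew_symmetric (\<lambda>x. S x - c *\<^sub>R T x)" by (simp add: skew_symmetric_def)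
  moreover have "nabla br x (S y - c *\<^sub>R T y) \<bullet> z + nabla br x y \<bullet> (S z - c *\<^sub>R T z)
      + (nabla br y (S x - c *\<^sub>R T x) \<bullet> z + nabla br y x \<bullet> (S z - c *\<^sub>R T z))
    = 2 * (x \<bullet> y) * ((\<eta> - c *\<^sub>R \<xi>) \<bullet> z) - (y \<bullet> z) * ((\<eta> - c *\<^sub>R \<xi>) \<bullet> x)
      - (x \<bullet> z) * ((\<eta> - c *\<^sub>R \<xi>) \<bullet> y)" for x y z
  proof -
    have "nabla br x (S y - c *\<^sub>R T y) \<bullet> z + nabla br x y \<bullet> (S z - c *\<^sub>R T z)
        + (nabla br y (S x - c *\<^sub>R T x) \<bullet> z + nabla br y x \<bullet> (S z - c *\<^sub>R T z))
      = nabla br x (S y) \<bullet> z + nabla br x y \<bullet> S z + (nabla br y (S x) \<bullet> z + nabla br y x \<bullet> S z)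
        - c * (nabla br x (T y) \<bullet> z + nabla br x y \<bullet> T z + (nabla br y (T x) \<bullet> z + nabla br y x \<bullet> T z))"
      by (simp add: linear_diff[OF lin] linear_scale[OF lin] inner_diff_left inner_diff_right algebra_simps)
    also have "\<dots> = 2 * (x \<bullet> y) * (\<eta> \<bullet> z) - (y \<bullet> z) * (\<eta> \<bullet> x) - (x \<bullet> z) * (\<eta> \<bullet> y)
        - c * (2 * (x \<bullet> y) * (\<xi> \<bullet> z) - (y \<bullet> z) * (\<xi> \<bullet> x) - (x \<bullet> z) * (\<xi> \<bullet> y))"
      using S T by presburger
    finally show ?thesis by (simp add: inner_diff_left algebra_simps)
  qed
  ultimately show ?thesis by (simp add: cky_endo_def)
qed

context metric_lie_algebra
begin

lemma br_antisym: "br y x = - br x y"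
proof -
  have "br (x + y) (x + y) = (br x x + br x y) + (br y x + br y y)"
    by (simp only: bilinear_ladd[OF bilinear_br] bilinear_radd[OF bilinear_br] ac_simps)
  then have "br x y + br y x = 0" by (simp add: br_self)
  then show ?thesis by (simp add: add_eq_0_iff)
qed

lemma nabla_inner: "nabla br x y \<bullet> z = (br x y \<bullet> z - br y z \<bullet> x + br z x \<bullet> y) / 2"
  using nabla_koszul[of x y z] by simp

lemma linear_nabla_left: "linear (\<lambda>x. nabla br x y)"
proof (rule linearI)
  fix x x' :: 'a and c :: real
  show "nabla br (x + x') y = nabla br x y + nabla br x' y"
    using bilinear_br
    by (subst vector_eq_rdot[symmetric])
      (simp add: inner_add_left inner_add_right nabla_inner bilinear_ladd bilinear_radd field_simps)
  show "nabla br (c *\<^sub>R x) y = c *\<^sub>R nabla br x y"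
    using bilinear_br
    by (subst vector_eq_rdot[symmetric])
      (simp add: nabla_inner bilinear_lmul bilinear_rmul algebra_simps)
qed

lemma skew_symmetric_nabla: "skew_symmetric (nabla br x)"
proof -
  have "nabla br x y \<bullet> z = - (y \<bullet> nabla br x z)" for y z
    unfolding inner_commute[of y] nabla_inner
    using br_antisym[of z y] br_antisym[of x y] br_antisym[of x z] by (simp add: field_simps)
  then show ?thesis using linear_nabla by (simp add: skew_symmetric_def)
qed

lemma nabla_torsion_free: "nabla br x y - nabla br y x = br x y"
proof (subst vector_eq_rdot[symmetric], intro allI)
  show "(nabla br x y - nabla br y x) \<bullet> z = br x y \<bullet> z" for z
    using br_antisym[of x y] br_antisym[of z y] br_antisym[of z x]
    by (simp add: inner_diff_left nabla_inner field_simps)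
qed

lemma nabla_inner_swap: "nabla br x y \<bullet> z = - (nabla br x z \<bullet> y)"
  by (subst skew_symmetric_inner[OF skew_symmetric_nabla]) (simp add: inner_commute)

end

section \<open>Consequences of centrality: \<open>A\<close> inverts \<open>T\<close> off
  \<xi>\<close>

locale central_cky = metric_lie_algebra br for br :: "'a::euclidean_space \<Rightarrow> 'a \<Rightarrow> 'a" +
  fixes T :: "'a \<Rightarrow> 'a" and \<xi> :: 'a
  assumes dim5: "DIM('a) = 5" and cky_T: "cky_endo br T \<xi>"
    and unit: "\<xi> \<bullet> \<xi> = 1" and central: "\<xi> \<in> center br"
begin

lemma cky_endo_skew: "cky_endo br S \<eta> \<Longrightarrow> skew_symmetric S"
  by (simp add: cky_endo_def)

lemma cky_endo_equation:
  "cky_endo br S \<eta> \<Longrightarrow>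
    nabla br x (S y) \<bullet> z + nabla br x y \<bullet> S z + (nabla br y (S x) \<bullet> z + nabla br y x \<bullet> S z) =
      2 * (x \<bullet> y) * (\<eta> \<bullet> z) - (y \<bullet> z) * (\<eta> \<bullet> x) - (x \<bullet> z) * (\<eta> \<bullet> y)"
  by (simp add: cky_endo_def)

lemmas skew_T = cky_endo_skew[OF cky_T]
lemmas linear_T = skew_symmetric_linear[OF skew_T]

definition A :: "'a \<Rightarrow> 'a" where "A = nabla br \<xi>"

lemma skew_A: "skew_symmetric A" unfolding A_def by (rule skew_symmetric_nabla)

lemmas linear_A = skew_symmetric_linear[OF skew_A]

lemma nabla_\<xi>: "nabla br x \<xi> = A x" "nabla br \<xi> x = A x"
proof -
  have "br \<xi> x = 0" using central by (simp add: center_def)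
  then show "nabla br x \<xi> = A x" "nabla br \<xi> x = A x"
    using nabla_torsion_free[of \<xi> x] by (simp_all add: A_def)
qed

lemma A_\<xi>: "A \<xi> = 0"
proof (subst vector_eq_rdot[symmetric], intro allI)
  have "br \<xi> z = 0" for z using central by (simp add: center_def)
  then show "A \<xi> \<bullet> z = 0 \<bullet> z" for z
    using br_antisym[of z \<xi>] by (simp add: A_def nabla_inner)
qed

lemma \<xi>_nonzero: "\<xi> \<noteq> 0" using unit by auto

lemma A_horizontal: "A x \<bullet> \<xi> = 0"
  using skew_symmetric_inner[OF skew_A, of x \<xi>] by (simp add: A_\<xi>)

text \<open>The equation at \<open>(\<xi>, \<xi>, z)\<close>, where \<open>A \<xi> = 0\<close>
  removes one term. It lets \<open>S \<xi>\<close> determine the part of \<open>\<eta>\<close>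
  orthogonal to \<xi>.\<close>

lemma cky_endo_\<xi>_\<xi>:
  assumes "cky_endo br S \<eta>"
  shows "A (S \<xi>) = \<eta> - (\<eta> \<bullet> \<xi>) *\<^sub>R \<xi>"
proof (subst vector_eq_rdot[symmetric], intro allI)
  show "A (S \<xi>) \<bullet> z = (\<eta> - (\<eta> \<bullet> \<xi>) *\<^sub>R \<xi>) \<bullet> z" for z
    using cky_endo_equation[OF assms, of \<xi> \<xi> z] by (simp add: nabla_\<xi> A_\<xi> unit inner_diff_left)
qed

lemma cky_endo_\<xi>:
  assumes "cky_endo br S \<eta>" "x \<bullet> \<xi> = 0"
  shows "A (S x) \<bullet> z + 2 * (A x \<bullet> S z) + nabla br x (S \<xi>) \<bullet> z = - (x \<bullet> z) * (\<eta> \<bullet> \<xi>) - (\<xi> \<bullet> z) * (\<eta> \<bullet> x)"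
  using cky_endo_equation[OF assms(1), of \<xi> x z] assms(2) by (simp add: nabla_\<xi> inner_commute[of \<xi> x])

text \<open>With \<open>x\<close> and \<open>z\<close> both equal to \<open>T \<xi>\<close> in
  \<open>cky_endo_\<xi>\<close>, the left side vanishes by skewness and
  \<open>A (T \<xi>) = 0\<close>, leaving the squared length of \<open>T \<xi>\<close>.\<close>

lemma T_\<xi>: "T \<xi> = 0"
proof -
  let ?v = "T \<xi>"
  have "A ?v = 0" using cky_endo_\<xi>_\<xi>[OF cky_T] by (simp add: unit)
  moreover have "?v \<bullet> \<xi> = 0" by (rule skew_symmetric_inner_self[OF skew_T])
  moreover have "A (T ?v) \<bullet> ?v = - (T ?v \<bullet> A ?v)" by (rule skew_symmetric_inner[OF skew_A])
  ultimately have "?v \<bullet> ?v = 0"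
    using cky_endo_\<xi>[OF cky_T, of ?v ?v]
    by (simp add: skew_symmetric_inner_self[OF skew_symmetric_nabla] unit inner_commute[of \<xi> ?v])
  then show ?thesis by simp
qed

lemma T_horizontal: "T x \<bullet> \<xi> = 0"
  using skew_symmetric_inner[OF skew_T, of x \<xi>] by (simp add: T_\<xi>)

lemma horizontal_eqI:
  assumes "x \<bullet> \<xi> = 0" "y \<bullet> \<xi> = 0" "\<And>z. z \<bullet> \<xi> = 0 \<Longrightarrow> x \<bullet> z = y \<bullet> z"
  shows "x = y"
proof -
  have "(x - y) \<bullet> (x - y) = 0"
    using assms(3)[of "x - y"] assms(1,2) by (simp add: inner_diff_left)
  then show ?thesis by simp
qed

text \<open>Since \<open>T \<xi> = 0\<close>, \<open>cky_endo_\<xi>\<close> is a linear equation in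
  \<open>A (T x) \<bullet> z\<close> and \<open>A x \<bullet> T z\<close>. Exchanging
  \<open>x\<close> and \<open>z\<close> gives a second, independent one, and the two determine both
  numbers.\<close>

lemma A_T: "x \<bullet> \<xi> = 0 \<Longrightarrow> A (T x) = x" and T_A: "x \<bullet> \<xi> = 0 \<Longrightarrow> T (A x) = x"
proof -
  assume x: "x \<bullet> \<xi> = 0"
  have *: "A (T x) \<bullet> z = x \<bullet> z \<and> T (A x) \<bullet> z = x \<bullet> z" if z: "z \<bullet> \<xi> = 0" for z
  proof -
    have eq: "A (T x) \<bullet> z + 2 * (A x \<bullet> T z) = - (x \<bullet> z)" if "x \<bullet> \<xi> = 0" "z \<bullet> \<xi> = 0" for x z
      using cky_endo_\<xi>[OF cky_T that(1), of z] that
      by (simp add: T_\<xi> unit linear_0[OF linear_nabla] inner_commute[of \<xi> z])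
    have "A (T z) \<bullet> x = - (A x \<bullet> T z)" "A z \<bullet> T x = - (A (T x) \<bullet> z)"
      by (subst skew_symmetric_inner[OF skew_A], simp add: inner_commute)+
    moreover have "T (A x) \<bullet> z = - (A x \<bullet> T z)" by (rule skew_symmetric_inner[OF skew_T])
    ultimately show ?thesis
      using eq[OF x z] eq[OF z x] by (simp add: inner_commute[of z x])
  qed
  show "A (T x) = x" "T (A x) = x"
    by (rule horizontal_eqI; use * x A_horizontal T_horizontal in simp)+
qed

definition P :: "'a \<Rightarrow> 'a" where "P x = x - (x \<bullet> \<xi>) *\<^sub>R \<xi>"

lemma P_horizontal: "P x \<bullet> \<xi> = 0" by (simp add: P_def inner_diff_left unit)

lemma P_id: "x \<bullet> \<xi> = 0 \<Longrightarrow> P x = x" by (simp add: P_def)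

lemma P_inner: "z \<bullet> \<xi> = 0 \<Longrightarrow> P x \<bullet> z = x \<bullet> z"
  by (simp add: P_def inner_diff_left inner_commute[of \<xi> z])

lemma P_inner_left: "P x \<bullet> z = x \<bullet> P z"
  by (simp add: P_def inner_diff_left inner_diff_right inner_commute)

lemma linear_P: "linear P"
  by (rule linearI) (simp_all add: P_def inner_add_left algebra_simps)

lemma A_P: "A (P x) = A x"
  by (simp add: P_def linear_diff[OF linear_A] linear_scale[OF linear_A] A_\<xi>)

lemma T_P: "T (P x) = T x"
  by (simp add: P_def linear_diff[OF linear_T] linear_scale[OF linear_T] T_\<xi>)

lemma T_A_P: "T (A x) = P x"
  using T_A[OF P_horizontal, of x] by (simp add: A_P)

section \<open>Adapted frames and parallelism of \<open>T\<close> off \<xi>\<close>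

text \<open>Dual form of the statement that these four vectors and \<xi> span the space, so vectors
  can be compared through inner products without coordinates.\<close>

definition separating_frame :: "'a \<Rightarrow> 'a \<Rightarrow> bool" where
  "separating_frame p q \<longleftrightarrow> (\<forall>x. x \<bullet> \<xi> = 0 \<longrightarrow> x \<bullet> p = 0 \<longrightarrow> x \<bullet> T p = 0 \<longrightarrow> x \<bullet> q = 0 \<longrightarrow> x \<bullet> T q = 0 \<longrightarrow> x = 0)"

lemma adapted_frame:
  obtains p q m n where "p \<bullet> \<xi> = 0" "q \<bullet> \<xi> = 0" "T (T p) = - (m *\<^sub>R p)" "T (T q) = - (n *\<^sub>R q)"
    "m \<noteq> 0" "n \<noteq> 0" "separating_frame p q"
proof -
  have "x = 0" if "x \<bullet> \<xi> = 0" "T x = 0" for x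
    using A_T[OF that(1)] that(2) by (simp add: linear_0[OF linear_A])
  from skew_symmetric_adapted_frame[OF dim5 skew_T T_\<xi> \<xi>_nonzero this] show thesis
    using that by (metis separating_frame_def)
qed

lemma linear_vanishes_on_frame:
  assumes "separating_frame p q" "linear f" "x \<bullet> \<xi> = 0" "p \<bullet> \<xi> = 0" "q \<bullet> \<xi> = 0"
    and zero: "f p = 0" "f (T p) = 0" "f q = 0" "f (T q) = 0"
  shows "f x = (0::real)"
proof -
  obtain r where r: "\<And>z. f z = r \<bullet> z" using ex_representing_vector[OF assms(2)] by blast
  have "P r \<bullet> z = f z" if "z \<bullet> \<xi> = 0" for z using that by (simp add: P_inner r)
  then have "P r = 0" "f x = P r \<bullet> x"
    using assms T_horizontal P_horizontal by (auto simp: separating_frame_def)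
  then show ?thesis by simp
qed

text \<open>The covariant derivative of \<open>T\<close> is totally skew-symmetric on the four-dimensional complement of
  \<open>\<xi>\<close>, and it vanishes on \<open>(x, p, T p)\<close> when \<open>p\<close> is an eigenvector of \<open>T\<^sup>2\<close>.\<close>

lemma T_parallel_on_horizontal:
  assumes "x \<bullet> \<xi> = 0" "y \<bullet> \<xi> = 0" "z \<bullet> \<xi> = 0"
  shows "nabla br x (T y) \<bullet> z + nabla br x y \<bullet> T z = 0"
proof -
  define C where "C x y z = nabla br x (T y) \<bullet> z + nabla br x y \<bullet> T z" for x y z
  have lin1: "linear (\<lambda>x. C x y z)" for y z
    unfolding C_def
    by (rule linearI) (simp_all add: linear_add[OF linear_nabla_left] linear_scale[OF linear_nabla_left]
        inner_add_left algebra_simps)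
  have lin2: "linear (\<lambda>y. C x y z)" for x z
    unfolding C_def
    by (rule linearI) (simp_all add: linear_add[OF linear_nabla] linear_scale[OF linear_nabla]
        linear_add[OF linear_T] linear_scale[OF linear_T] inner_add_left algebra_simps)
  have lin3: "linear (\<lambda>z. C x y z)" for x y
    unfolding C_def
    by (rule linearI) (simp_all add: linear_add[OF linear_T] linear_scale[OF linear_T]
        inner_add_right algebra_simps)
  have skew23: "C x z y = - C x y z" for x y z
    using nabla_inner_swap[of x "T z" y] nabla_inner_swap[of x z "T y"] by (simp add: C_def)
  \<comment> \<open>The right side of the equation carries a factor \<open>\<xi> \<bullet> _\<close>
    in each term, which vanishes on the complement.\<close>
  have skew12: "C y x z = - C x y z" if "x \<bullet> \<xi> = 0" "y \<bullet> \<xi> = 0" "z \<bullet> \<xi> = 0" for x y z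
    using cky_endo_equation[OF cky_T, of x y z] that by (simp add: C_def inner_commute[of \<xi>])
  obtain p q m n where frame: "p \<bullet> \<xi> = 0" "q \<bullet> \<xi> = 0" "T (T p) = - (m *\<^sub>R p)" "T (T q) = - (n *\<^sub>R q)"
    "separating_frame p q"
    by (rule adapted_frame)
  have plane: "C x r (T r) = 0" if "T (T r) = - (l *\<^sub>R r)" for x r l
    by (simp add: C_def that skew_symmetric_inner_self[OF skew_symmetric_nabla])
  note planes = plane[OF frame(3)] plane[OF frame(4)]
  note hor = frame(1,2) T_horizontal
  define F where "F = {p, T p, q, T q}"
  have F_hor: "f \<bullet> \<xi> = 0" if "f \<in> F" for f using that hor by (auto simp: F_def)
  have vanish: "g x = 0" if "linear g" "x \<bullet> \<xi> = 0" "\<And>f. f \<in> F \<Longrightarrow> g f = 0" for g :: "'a \<Rightarrow> real" and x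
    using linear_vanishes_on_frame[OF frame(5) that(1,2) frame(1,2)] that(3) by (simp add: F_def)
  \<comment> \<open>Three distinct members of the four-element list \<open>p, T p, q, T q\<close>
    contain \<open>p, T p\<close> or \<open>q, T q\<close>, so \<open>planes\<close> and the
    skew-symmetries apply; repeated arguments give zero anyway.\<close>
  have FFF: "C e f g = 0" if "e \<in> F" "f \<in> F" "g \<in> F" for e f g
  proof -
    have "C x p (T p) = 0" "C x (T p) p = 0" "C x q (T q) = 0" "C x (T q) q = 0" for x
      using planes skew23[of x p "T p"] skew23[of x q "T q"] by simp_all
    moreover from this have "C p x (T p) = 0" "C (T p) x p = 0" "C q x (T q) = 0" "C (T q) x q = 0"
      if "x \<in> F" for x
      using skew12[of x p "T p"] skew12[of x "T p" p] skew12[of x q "T q"] skew12[of x "T q" q]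
        F_hor[OF that] hor by simp_all
    moreover from this have "C p (T p) x = 0" "C (T p) p x = 0" "C q (T q) x = 0" "C (T q) q x = 0"
      if "x \<in> F" for x
      using skew23[of p x "T p"] skew23[of "T p" x p] skew23[of q x "T q"] skew23[of "T q" x q] that
      by simp_all
    moreover have "C x y y = 0" for x y using skew23[of x y y] by simp
    moreover have "C y y x = 0" if "x \<in> F" "y \<in> F" for x y
      using skew12[of y y x] F_hor that by simp
    moreover from this have "C y x y = 0" if "x \<in> F" "y \<in> F" for x y
      using skew23[of y x y] that by simp
    ultimately show ?thesis using that unfolding F_def by auto
  qed
  have "C e f z = 0" if "e \<in> F" "f \<in> F" for e f
    using vanish[OF lin3 assms(3)] FFF that by blast
  then have "C e y z = 0" if "e \<in> F" for e
    using vanish[OF lin2 assms(2)] that by blast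
  then have "C x y z = 0"
    using vanish[OF lin1 assms(1)] by blast
  then show ?thesis by (simp add: C_def)
qed

section \<open>The induced connection and the reduction of a second tensor\<close>

text \<open>The connection induced by \<open>nabla br\<close> on the orthogonal complement of \<open>\<xi>\<close>, extended by zero.\<close>

definition D :: "'a \<Rightarrow> 'a \<Rightarrow> 'a" where "D x y = P (nabla br (P x) (P y))"

lemma skew_D: "skew_symmetric (D x)"
proof -
  have "linear (P \<circ> nabla br (P x) \<circ> P)"
    by (intro linear_compose linear_P linear_nabla)
  moreover have "D x = P \<circ> nabla br (P x) \<circ> P" by (simp add: D_def fun_eq_iff)
  moreover have "D x y \<bullet> z = - (y \<bullet> D x z)" for y z
    by (simp add: D_def P_inner_left skew_symmetric_inner[OF skew_symmetric_nabla])
  ultimately show ?thesis by (simp add: skew_symmetric_def)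
qed

lemma D_P: "D x (P y) = D x y"
  by (simp add: D_def P_id P_horizontal)

lemma D_inner:
  assumes "x \<bullet> \<xi> = 0" "y \<bullet> \<xi> = 0" "z \<bullet> \<xi> = 0"
  shows "D x y \<bullet> z = nabla br x y \<bullet> z"
  using assms by (simp add: D_def P_inner P_id)

lemma D_T: "D x (T y) = T (D x y)"
proof (rule horizontal_eqI)
  show "D x (T y) \<bullet> \<xi> = 0" "T (D x y) \<bullet> \<xi> = 0" by (simp_all add: D_def P_horizontal T_horizontal)
  fix z assume z: "z \<bullet> \<xi> = 0"
  have "D x (T y) \<bullet> z = nabla br (P x) (T (P y)) \<bullet> z"
    using z by (simp add: D_def P_inner P_id T_horizontal T_P)
  also have "\<dots> = - (nabla br (P x) (P y) \<bullet> T z)"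
    using T_parallel_on_horizontal[of "P x" "P y" z] z P_horizontal by simp
  also have "\<dots> = T (D x y) \<bullet> z"
    by (simp add: skew_symmetric_inner[OF skew_T] D_def P_inner T_horizontal T_\<xi>)
  finally show "D x (T y) \<bullet> z = T (D x y) \<bullet> z" .
qed

text \<open>\<open>A\<close> and \<open>T\<close> are mutually inverse on the complement, so
  commutation passes from \<open>T\<close> to \<open>A\<close>.\<close>

lemma D_A: "D x (A y) = A (D x y)"
proof -
  have "D x (A y) \<bullet> \<xi> = 0" by (simp add: D_def P_horizontal)
  then have "D x (A y) = A (T (D x (A y)))" by (simp add: A_T)
  also have "\<dots> = A (D x y)" by (simp add: D_T[symmetric] T_A_P D_P)
  finally show ?thesis .
qed

text \<open>The formula for \<open>D x (S \<xi>)\<close> is the equation with \<xi> in one slot; the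
  symmetrized one has three horizontal slots. There the component of \<open>S x\<close> along \<xi>
  contributes through \<open>nabla br x \<xi> = A x\<close>, and
  \<open>\<eta> = A (S \<xi>)\<close>.\<close>

lemma reduced_cky_compression:
  assumes S: "cky_endo br S \<eta>" and \<eta>: "\<eta> \<bullet> \<xi> = 0"
  shows "reduced_cky \<xi> (S \<xi>) D A (\<lambda>x. P (S (P x)))"
proof
  note skew_S = cky_endo_skew[OF S]
  note linear_S = skew_symmetric_linear[OF skew_S]
  define v where "v = S \<xi>"
  define S' where "S' x = P (S (P x))" for x
  have v: "v \<bullet> \<xi> = 0" unfolding v_def by (rule skew_symmetric_inner_self[OF skew_S])
  have \<eta>_eq: "\<eta> = A v" using cky_endo_\<xi>_\<xi>[OF S] \<eta> by (simp add: v_def)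
  have S'_hor: "S' x \<bullet> \<xi> = 0" for x by (simp add: S'_def P_horizontal)
  have S_hor: "S x = S' x - (x \<bullet> v) *\<^sub>R \<xi>" if "x \<bullet> \<xi> = 0" for x
  proof -
    have "S x \<bullet> \<xi> = - (x \<bullet> v)" unfolding v_def by (rule skew_symmetric_inner[OF skew_S])
    then show ?thesis using that by (simp add: S'_def P_id) (simp add: P_def)
  qed
  show "DIM('a) = 5" "\<xi> \<noteq> 0" "skew_symmetric (D x)" "skew_symmetric A" "A \<xi> = 0" "D x (A y) = A (D x y)" for x y
    using dim5 \<xi>_nonzero skew_D skew_A A_\<xi> D_A by auto
  show "S \<xi> \<bullet> \<xi> = 0" using v by (simp add: v_def)
  show "P (S (P \<xi>)) = 0" by (simp add: P_def unit linear_0[OF linear_S])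
  have "linear (P \<circ> S \<circ> P)" by (intro linear_compose linear_P linear_S)
  moreover have "P (S (P x)) \<bullet> y = - (x \<bullet> P (S (P y)))" for x y
    by (simp add: P_inner_left skew_symmetric_inner[OF skew_S])
  ultimately show "skew_symmetric (\<lambda>x. P (S (P x)))" by (simp add: skew_symmetric_def comp_def)
  show "D x (S \<xi>) = 2 *\<^sub>R P (S (P (A x))) - A (P (S (P x)))" for x
    unfolding v_def[symmetric] S'_def[symmetric]
  proof (rule horizontal_eqI)
    show "D x v \<bullet> \<xi> = 0" "(2 *\<^sub>R S' (A x) - A (S' x)) \<bullet> \<xi> = 0"
      by (simp_all add: D_def P_horizontal S'_hor A_horizontal inner_diff_left)
    fix z assume z: "z \<bullet> \<xi> = 0"
    have "A (S (P x)) \<bullet> z + 2 * (A (P x) \<bullet> S z) + nabla br (P x) v \<bullet> z = 0"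
      using cky_endo_\<xi>[OF S P_horizontal, of x z] z \<eta> by (simp add: v_def inner_commute[of \<xi>])
    moreover have "A (S (P x)) = A (S' x)" by (simp add: S'_def A_P)
    moreover have "A (P x) \<bullet> S z = - (S' (A x) \<bullet> z)"
      using z by (simp add: A_P S'_def P_inner P_id A_horizontal skew_symmetric_inner[OF skew_S])
    moreover have "nabla br (P x) v \<bullet> z = D x v \<bullet> z" using z v by (simp add: D_def P_inner P_id)
    ultimately show "D x v \<bullet> z = (2 *\<^sub>R S' (A x) - A (S' x)) \<bullet> z"
      by (simp add: inner_diff_left)
  qed
  fix x y z assume hor: "x \<bullet> \<xi> = 0" "y \<bullet> \<xi> = 0" "z \<bullet> \<xi> = 0"
  have first: "D x (S' y) \<bullet> z = nabla br x (S y) \<bullet> z + (y \<bullet> v) * (A x \<bullet> z)"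
    if "x \<bullet> \<xi> = 0" "y \<bullet> \<xi> = 0" for x y
    using that hor(3)
    by (simp add: D_inner S'_hor S_hor linear_diff[OF linear_nabla] linear_scale[OF linear_nabla]
        nabla_\<xi> inner_diff_left)
  have second: "D x y \<bullet> S' z = nabla br x y \<bullet> S z - (z \<bullet> v) * (A x \<bullet> y)"
    if "x \<bullet> \<xi> = 0" "y \<bullet> \<xi> = 0" for x y
    using that hor(3)
    by (simp add: D_inner S'_hor S_hor inner_diff_right skew_symmetric_inner[OF skew_symmetric_nabla, of x y \<xi>]
        nabla_\<xi> inner_commute[of y])
  have "A y \<bullet> x = - (A x \<bullet> y)"
    by (subst skew_symmetric_inner[OF skew_A]) (simp add: inner_commute)
  then show "D x (P (S (P y))) \<bullet> z + D x y \<bullet> P (S (P z)) + (D y (P (S (P x))) \<bullet> z + D y x \<bullet> P (S (P z))) =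
    (y \<bullet> S \<xi>) * (A x \<bullet> z) + (x \<bullet> S \<xi>) * (A y \<bullet> z) + 2 * (x \<bullet> y) * (A (S \<xi>) \<bullet> z)
    - (A (S \<xi>) \<bullet> x) * (y \<bullet> z) - (A (S \<xi>) \<bullet> y) * (x \<bullet> z)"
    using cky_endo_equation[OF S, of x y z] first[OF hor(1,2)] first[OF hor(2,1)]
      second[OF hor(1,2)] second[OF hor(2,1)]
    unfolding v_def[symmetric] S'_def[symmetric] \<eta>_eq by (simp add: algebra_simps)
qed

section \<open>Vanishing and uniqueness of conformal Killing-Yano tensors\<close>

lemma S_\<xi>_eq_0:
  assumes S: "cky_endo br S \<eta>" and \<eta>: "\<eta> \<bullet> \<xi> = 0"
  shows "S \<xi> = 0"
proof -
  interpret R: reduced_cky \<xi> "S \<xi>" D A "\<lambda>x. P (S (P x))"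
    by (rule reduced_cky_compression[OF S \<eta>])
  have A_eigen: "A r = - ((1 / l) *\<^sub>R T r)" if "T (T r) = - (l *\<^sub>R r)" "l \<noteq> 0" for r l
  proof -
    have "T r = A (T (T r))" by (simp add: A_T T_horizontal)
    then have "T r = - (l *\<^sub>R A r)"
      by (simp add: that linear_neg[OF linear_A] linear_scale[OF linear_A])
    then show ?thesis using that by simp
  qed
  have A2_eigen: "A (A r) = - ((1 / l) *\<^sub>R r)" if "T (T r) = - (l *\<^sub>R r)" "l \<noteq> 0" "r \<bullet> \<xi> = 0" for r l
    by (simp add: A_eigen[OF that(1,2)] linear_neg[OF linear_A] linear_scale[OF linear_A] A_T that)
  obtain p q m n where frame: "p \<bullet> \<xi> = 0" "q \<bullet> \<xi> = 0" "T (T p) = - (m *\<^sub>R p)" "T (T q) = - (n *\<^sub>R q)"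
    "m \<noteq> 0" "n \<noteq> 0" "separating_frame p q"
    by (rule adapted_frame)
  have T_sym: "T (T x) \<bullet> y = x \<bullet> T (T y)" for x y by (simp add: skew_symmetric_inner[OF skew_T])
  have T_frame: "T (T (T p)) = - (m *\<^sub>R T p)" "T (T (T q)) = - (n *\<^sub>R T q)"
    by (simp_all add: frame linear_neg[OF linear_T] linear_scale[OF linear_T])
  show ?thesis
  proof (cases "m = n")
    case True
    have "T (T x) = - (m *\<^sub>R x)" if "x \<bullet> \<xi> = 0" for x
    proof -
      have "T (T x) + m *\<^sub>R x = 0"
        using frame(7)[unfolded separating_frame_def, rule_format, of "T (T x) + m *\<^sub>R x"]
        by (simp add: inner_add_left T_horizontal T_sym frame T_frame True that
            linear_neg[OF linear_T] linear_scale[OF linear_T])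
      then show ?thesis by (simp add: add_eq_0_iff2)
    qed
    then have "A (A x) = - ((1 / m) *\<^sub>R x)" if "x \<bullet> \<xi> = 0" for x
      using A2_eigen frame that by blast
    then show ?thesis using R.v_eq_0_if_A_square_scalar[of "1 / m"] frame by simp
  next
    case False
    have orth: "S \<xi> \<bullet> r = 0"
      if r: "r \<bullet> \<xi> = 0" "T (T r) = - (l *\<^sub>R r)" "l \<noteq> 0" and q: "T (T q) = - (n *\<^sub>R q)" "l \<noteq> n"
        and sep: "separating_frame r q" for r q l n
    proof (cases "r = 0")
      case r0: False
      \<comment> \<open>\<open>D x\<close> commutes with the self-adjoint square of
        \<open>T\<close>, so it preserves eigenspaces, and those for \<open>l\<close> and
        \<open>n\<close> are orthogonal.\<close>
      have D_perp: "D x r \<bullet> q' = 0" if "T (T q') = - (n *\<^sub>R q')" for x q'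
      proof -
        have "T (T (D x r)) \<bullet> q' = - (l * (D x r \<bullet> q'))"
          by (simp add: D_T[symmetric] r linear_neg[OF R.linear_D] linear_scale[OF R.linear_D])
        then show ?thesis using T_sym[of "D x r" q'] that q by simp
      qed
      have "T (T (T q)) = - (n *\<^sub>R T q)" by (simp add: q linear_neg[OF linear_T] linear_scale[OF linear_T])
      note perp = D_perp[OF q(1)] D_perp[OF this]
      have Tr: "T r \<noteq> 0" using A_T[OF r(1)] r0 by (auto simp: linear_0[OF linear_A])
      define c where "c = (D r r \<bullet> T r) / (T r \<bullet> T r)"
      have T_r_perp: "T r \<bullet> q' = 0" if "T (T q') = - (n *\<^sub>R q')" for q'
      proof -
        have "T (T (T r)) = - (l *\<^sub>R T r)" by (simp add: r linear_neg[OF linear_T] linear_scale[OF linear_T])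
        then show ?thesis using T_sym[of "T r" q'] that q by simp
      qed
      have "D r r - c *\<^sub>R T r = 0"
        using sep[unfolded separating_frame_def, rule_format, of "D r r - c *\<^sub>R T r"] Tr perp
          T_r_perp[OF q(1)] T_r_perp[OF \<open>T (T (T q)) = - (n *\<^sub>R T q)\<close>]
        by (simp add: inner_diff_left T_horizontal D_def[of r r] P_horizontal)
          (simp add: D_def[symmetric] R.inner_self_simps skew_symmetric_inner_self[OF skew_T] c_def)
      then have "D r r = (- (c * l)) *\<^sub>R A r" by (simp add: A_eigen[OF r(2,3)] r(3))
      then show ?thesis
        using R.v_orthogonal_to_parallel_plane[OF r0 r(1) A2_eigen[OF r(2,3,1)] _ \<open>D r r = _\<close>] r(3) by simp
    qed simp
    \<comment> \<open>\<open>orth\<close> is applied once per frame vector, so each vector must in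
      turn take the first place of a separating frame.\<close>
    have "separating_frame (T p) q" "separating_frame q p" "separating_frame (T q) p"
      using frame(7) frame(5,6) unfolding separating_frame_def by (simp_all add: frame(3,4))
    then have "S \<xi> \<bullet> p = 0" "S \<xi> \<bullet> T p = 0" "S \<xi> \<bullet> q = 0" "S \<xi> \<bullet> T q = 0"
      using orth[of p m q n] orth[of "T p" m q n] orth[of q n p m] orth[of "T q" n p m]
        frame T_frame T_horizontal False by auto
    then show ?thesis
      using frame(7) R.v_horizontal by (simp add: separating_frame_def)
  qed
qed

lemma cky_endo_eq_0:
  assumes S: "cky_endo br S \<eta>" and \<eta>: "\<eta> \<bullet> \<xi> = 0"
  shows "S x = 0"
proof -
  interpret R: reduced_cky \<xi> "S \<xi>" D A "\<lambda>x. P (S (P x))"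
    by (rule reduced_cky_compression[OF S \<eta>])
  define S' where "S' x = P (S (P x))" for x
  note S\<xi> = S_\<xi>_eq_0[OF S \<eta>]
  note linear_S = skew_symmetric_linear[OF cky_endo_skew[OF S]]
  have "2 *\<^sub>R S' (A y) = A (S' y)" for y
    using R.D_v[of y] by (simp add: S\<xi> linear_0[OF R.linear_D] S'_def)
  then have half: "2 * (S' (A y) \<bullet> z) = A (S' y) \<bullet> z" for y z
    by (metis inner_scaleR_left)
  moreover have "A (S' y) \<bullet> z = S' (A z) \<bullet> y" for y z
    unfolding S'_def
    by (simp add: skew_symmetric_inner[OF skew_A, of _ z] skew_symmetric_inner[OF R.skew_S, of y] inner_commute[of y])
  ultimately have "2 * (S' (A y) \<bullet> z) = S' (A z) \<bullet> y" for y z by simp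
  \<comment> \<open>Using the relation twice, with \<open>y\<close> and \<open>z\<close> exchanged,
    makes the number equal to four times itself.\<close>
  then have "S' (A y) \<bullet> z = 0" for y z by (smt (verit))
  then have "S' (A y) = 0" for y by (metis inner_eq_zero_iff)
  then have "S' (P x) = 0" using A_T[OF P_horizontal, of x] by metis
  then have "P (S (P x)) = 0" by (simp add: S'_def P_id P_horizontal)
  moreover have "S (P x) \<bullet> \<xi> = 0"
    by (simp add: skew_symmetric_inner[OF cky_endo_skew[OF S]] S\<xi>)
  ultimately have "S (P x) = 0" by (simp add: P_id)
  then show ?thesis
    by (simp add: P_def linear_diff[OF linear_S] linear_scale[OF linear_S] S\<xi>)
qed

lemma cky_endo_eq_multiple:
  assumes "cky_endo br S \<eta>"
  shows "S x = (\<eta> \<bullet> \<xi>) *\<^sub>R T x"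
proof -
  have "(\<eta> - (\<eta> \<bullet> \<xi>) *\<^sub>R \<xi>) \<bullet> \<xi> = 0" by (simp add: inner_diff_left unit)
  with cky_endo_diff_scaleR[OF metric_lie_algebra_axioms assms cky_T]
  have "S x - (\<eta> \<bullet> \<xi>) *\<^sub>R T x = 0" by (rule cky_endo_eq_0)
  then show ?thesis by simp
qed

text \<open>Absence of torsion turns the expression into a cyclic sum of covariant derivatives of
  \<open>T\<close>. Bracket and \<open>T\<close> both ignore components along \<xi>, so projected
  arguments suffice, and there \<open>T\<close> is parallel.\<close>

lemma T_closed: "T (br x y) \<bullet> z + T (br y z) \<bullet> x + T (br z x) \<bullet> y = 0"
proof -
  define N where "N x y z = nabla br x (T y) \<bullet> z + nabla br x y \<bullet> T z" for x y z
  have br_P: "br (P x) (P y) = br x y" for x y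
  proof -
    have "br \<xi> y = 0" "br y \<xi> = 0" for y
      using central br_antisym[of y \<xi>] by (simp_all add: center_def)
    then show ?thesis
      by (simp add: P_def bilinear_lsub[OF bilinear_br] bilinear_rsub[OF bilinear_br]
          bilinear_lmul[OF bilinear_br] bilinear_rmul[OF bilinear_br])
  qed
  have T_inner_P: "T x \<bullet> P y = T x \<bullet> y" for x y
    by (simp add: P_def inner_diff_right T_horizontal)
  have "T (br x y) \<bullet> z = T (nabla br x y) \<bullet> z - T (nabla br y x) \<bullet> z" for x y z
    by (simp add: nabla_torsion_free[symmetric] linear_diff[OF linear_T] inner_diff_left)
  moreover have "N x y z = T (nabla br x z) \<bullet> y - T (nabla br x y) \<bullet> z" for x y z
    by (simp add: N_def skew_symmetric_inner[OF skew_T] nabla_inner_swap[of x z "T y"])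
  ultimately have cyc: "T (br x y) \<bullet> z + T (br y z) \<bullet> x + T (br z x) \<bullet> y = - (N x y z + N y z x + N z x y)" for x y z
    by simp
  have "N (P x) (P y) (P z) = 0" for x y z
    unfolding N_def by (intro T_parallel_on_horizontal P_horizontal)
  with cyc[of "P x" "P y" "P z"] show ?thesis by (simp add: br_P T_inner_P)
qed

end

section \<open>Return from endomorphisms to spaces of two-forms\<close>

theorem theorem6p2:
  fixes br :: "'a::euclidean_space \<Rightarrow> 'a \<Rightarrow> 'a"
  assumes "metric_lie_algebra br"
    and "DIM('a) = 5"
    and "\<exists>\<omega> \<theta> \<xi>. CKY_with br \<omega> \<theta> \<and> \<theta> \<noteq> 0 \<and> (\<forall>x. blinfun_apply \<theta> x = \<xi> \<bullet> x) \<and> \<xi> \<in> center br"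
  shows "KY2 br = {0} \<and> starKY2 br = CKY2 br \<and> dim (CKY2 br) = 1 \<and>
    (\<forall>T. skew_symmetric T \<and> parallel br T \<longrightarrow> T = (\<lambda>x. 0))"
proof -
  interpret metric_lie_algebra br by (rule assms(1))
  obtain \<omega>\<^sub>0 \<theta>\<^sub>0 \<xi>\<^sub>0 where \<omega>\<^sub>0: "CKY_with br \<omega>\<^sub>0 \<theta>\<^sub>0" "\<theta>\<^sub>0 \<noteq> 0" "\<And>x. blinfun_apply \<theta>\<^sub>0 x = \<xi>\<^sub>0 \<bullet> x"
    "\<xi>\<^sub>0 \<in> center br"
    using assms(3) by blast
  have "\<xi>\<^sub>0 \<noteq> 0"
    using \<omega>\<^sub>0(2,3) by (auto intro: blinfun_eqI)
  define c where "c = 1 / norm \<xi>\<^sub>0"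
  define \<omega> where "\<omega> = c *\<^sub>R \<omega>\<^sub>0"
  define \<theta> where "\<theta> = c *\<^sub>R \<theta>\<^sub>0"
  define \<xi> where "\<xi> = c *\<^sub>R \<xi>\<^sub>0"
  have "c \<noteq> 0" using \<open>\<xi>\<^sub>0 \<noteq> 0\<close> by (simp add: c_def)
  have \<omega>: "CKY_with br \<omega> \<theta>" unfolding \<omega>_def \<theta>_def by (rule CKY_with_scale[OF \<omega>\<^sub>0(1)])
  have "\<theta> \<noteq> 0" using \<omega>\<^sub>0(2) \<open>c \<noteq> 0\<close> by (simp add: \<theta>_def)
  have \<theta>: "blinfun_apply \<theta> x = \<xi> \<bullet> x" for x
    by (simp add: \<theta>_def \<xi>_def blinfun.scaleR_left \<omega>\<^sub>0(3))
  have "\<xi> \<in> center br"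
    using \<omega>\<^sub>0(4) by (simp add: \<xi>_def center_def bilinear_lmul[OF bilinear_br])
  moreover have "norm \<xi> = 1" using \<open>\<xi>\<^sub>0 \<noteq> 0\<close> by (simp add: \<xi>_def c_def)
  then have "\<xi> \<bullet> \<xi> = 1" by (simp add: dot_square_norm)
  ultimately interpret central_cky br "endo_of_form \<omega>" \<xi>
    by unfold_locales (use assms(2) cky_endo_endo_of_form[OF \<omega> \<theta>] in auto)
  \<comment> \<open>The second conjunct is kept because it yields the vanishing of Killing-Yano
    forms.\<close>
  have multiple: "\<exists>a. \<omega>' = a *\<^sub>R \<omega> \<and> (\<theta>' = 0 \<longrightarrow> a = 0)" if "CKY_with br \<omega>' \<theta>'" for \<omega>' \<theta>'
  proof -
    obtain \<eta> where \<eta>: "\<And>x. blinfun_apply \<theta>' x = \<eta> \<bullet> x"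
      using ex_representing_vector[of "blinfun_apply \<theta>'"]
      by (metis blinfun.bounded_linear_right bounded_linear.linear)
    have "endo_of_form \<omega>' x = (\<eta> \<bullet> \<xi>) *\<^sub>R endo_of_form \<omega> x" for x
      by (rule cky_endo_eq_multiple[OF cky_endo_endo_of_form[OF that \<eta>]])
    then have "\<omega>' = (\<eta> \<bullet> \<xi>) *\<^sub>R \<omega>"
      by (intro blinfun_eqI) (simp add: blinfun.scaleR_left endo_of_form_inner)
    moreover have "\<eta> \<bullet> \<xi> = 0" if "\<theta>' = 0" using \<eta>[of \<xi>] that by simp
    ultimately show ?thesis by blast
  qed
  have CKY2: "CKY2 br = span {\<omega>}"
    unfolding CKY2_def span_singleton using multiple CKY_with_scale[OF \<omega>] by blast
  have "\<omega> \<noteq> 0"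
    using CKY_with_unique[OF \<omega>, of 0] CKY_with_zero \<open>\<theta> \<noteq> 0\<close> assms(2) by auto
  then have "dim (CKY2 br) = 1"
    unfolding CKY2 by (subst dim_eq_card[of "{\<omega>}"]) (simp_all add: span_span)
  moreover have "KY2 br = {0}"
  proof -
    have "\<omega>' = 0" if "CKY_with br \<omega>' 0" for \<omega>'
      using multiple[OF that] by auto
    then show ?thesis unfolding KY2_def using CKY_with_zero by blast
  qed
  moreover have "ext_deriv br (a *\<^sub>R \<omega>) x y z = 0" for a x y z
  proof -
    have "ext_deriv br (a *\<^sub>R \<omega>) x y z = - a * (endo_of_form \<omega> (br x y) \<bullet> z
        + endo_of_form \<omega> (br y z) \<bullet> x + endo_of_form \<omega> (br z x) \<bullet> y)"
      by (simp add: ext_deriv_def blinfun.scaleR_left endo_of_form_inner algebra_simps)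
    then show ?thesis by (simp add: T_closed)
  qed
  then have "starKY2 br = CKY2 br"
    by (auto simp: starKY2_def CKY2 span_singleton)
  moreover have "T = (\<lambda>x. 0)" if "skew_symmetric T" "parallel br T" for T
  proof
    have "nabla br x (T y) \<bullet> z + nabla br x y \<bullet> T z = 0" for x y z
      using that by (simp add: parallel_def flip: nabla_endo_inner)
    \<comment> \<open>A parallel tensor solves the equation with vector 0, which is orthogonal to
      \<xi>, so the vanishing result applies.\<close>
    then have "cky_endo br T 0" using that(1) by (simp add: cky_endo_def)
    then show "T x = 0" for x by (rule cky_endo_eq_0) simp
  qed
  ultimately show ?thesis by blast
qed

end
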